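(* Consider the plant $\dot x=f(x,u)$, $y=g(x)$ and the cost $\Phi$ satisfying the plant assumption, the cost assumption, and conditions (a)--(d) of the context. Let $$\mu_1=\frac{\mu_3}{2d_3},\quad \theta_1=\frac{\ell_f^2\zeta_3^2}{2\mu_3},\quad \theta_2=\frac{\ell_g^2\ell_{\Phi_y}^2}{2(\mu_\Phi-\ell_{\Phi_u})c_3},\quad \mu_2=\frac{\mu_\Phi-\ell_{\Phi_u}}{2}.$$ If there is $\xi>0$ such that $-\mu_1+\xi\theta_1<0$ and $\theta_2-\xi\mu_2<0$, then, for any $\alpha>0$, the closed-loop system $$\dot x=f(x,u),\qquad \dot u=-\alpha\tilde H(u)\nabla\Phi(u,g(x))$$ is globally exponentially stable, and, along every solution, $(u,y)$ with $y=g(x)$ converges to the unique solution $(u^\star,y^\star)$ of $\min_{u\in\mathbb{R}^m,\,y\in\mathbb{R}^p}\Phi(u,y)$ s.t. $y=h(u)$.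
   Context: Plant: $\dot x=f(x,u)$, $y=g(x)$, with $x\in\mathbb{R}^n$, $u\in\mathbb{R}^m$, $y\in\mathbb{R}^p$. Plant assumption: $f:\mathbb{R}^n\times\mathbb{R}^m\to\mathbb{R}^n$ and $g:\mathbb{R}^n\to\mathbb{R}^p$ are locally Lipschitz. For any constant input $u(t)=u\in\mathbb{R}^m$ the plant is globally asymptotically stable; hence there are a unique steady-state map $s:\mathbb{R}^m\to\mathbb{R}^n$ and a steady-state output map $h:\mathbb{R}^m\to\mathbb{R}^p$ with $f(s(u),u)=0$ and $h(u):=g(s(u))$ for all $u$. Furthermore, $h$ is continuously differentiable with locally Lipschitz Jacobian $\nabla h:\mathbb{R}^m\to\mathbb{R}^{p\times m}$. Cost assumption: $\Phi:\mathbb{R}^m\times\mathbb{R}^p\to\mathbb{R}$ is continuously differentiable with locally Lipschitz gradient, and $\min_{u,y}\Phi(u,y)$ s.t. $y=h(u)$ admits a solution. Notation: $\tilde H(u):=\begin{bmatrix} I_m & \nabla h(u)^\top\end{bmatrix}$, so $\tilde H(u)\nabla\Phi(u,y)=\nabla_u\Phi(u,y)+\nabla h(u)^\top\nabla_y\Phi(u,y)$. $\|\cdot\|$ is the Euclidean norm. Conditions (with Lipschitz constants $\ell_f,\ell_g,\ell_{\Phi_y},\ell_{\Phi_u}\ge0$ and $\mu_\Phi>0$): (a) $f(x,u)$ is $\ell_f$-Lipschitz in $u$ for any fixed $x\in\mathbb{R}^n$; $g$ is $\ell_g$-Lipschitz continuous. (b) There exist constants $c_3,d_3,\mu_3,\zeta_3>0$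 and a function $W:\mathbb{R}^n\times\mathbb{R}^m\to\mathbb{R}$, differentiable in its first argument, such that for any $u\in\mathbb{R}^m$ and $x\in\mathbb{R}^n$: $c_3\|x-s(u)\|^2\le W(x,u)\le d_3\|x-s(u)\|^2$; $\nabla_xW(x,u)^\top f(x,u)\le-\mu_3\|x-s(u)\|^2$; $\|\nabla_xW(x,u)\|\le\zeta_3\|x-s(u)\|$. (c) $\Phi(u,y)$ is $\mu_\Phi$-strongly convex in $u$ for any fixed $y\in\mathbb{R}^p$; the map $\tilde H(u)\nabla\Phi(u,y)$ is $\ell_{\Phi_y}$-Lipschitz continuous in $y$ for any fixed $u\in\mathbb{R}^m$. (d) The map $\nabla h(u)^\top\nabla_y\Phi(u,y)$ is $\ell_{\Phi_u}$-Lipschitz continuous in $u$ for any fixed $y\in\mathbb{R}^p$, and $\mu_\Phi>\ell_{\Phi_u}$. Globally exponentially stable means: with equilibrium $(x^\star,u^\star)$, $x^\star=s(u^\star)$, for every initial condition the solution is unique and defined for all $t\ge0$, and there are constants $K,\sigma>0$ such that $\|(x(t),u(t))-(x^\star,u^\star)\|\le Ke^{-\sigma t}\|(x(0),u(0))-(x^\star,u^\star)\|$ for all $t\ge0$ and all initial conditions. *)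

theory Defs
  imports "HOL-Analysis.Analysis"
begin

(* local_lipschitz expects a family of maps indexed by a parameter; here the family is constant. *)
definition locally_lipschitz :: "('a::metric_space \<Rightarrow> 'b::metric_space) \<Rightarrow> bool" where
  "locally_lipschitz F \<longleftrightarrow> local_lipschitz (UNIV :: real set) UNIV (\<lambda>_. F)"

definition grad :: "('a::euclidean_space \<Rightarrow> real) \<Rightarrow> 'a \<Rightarrow> 'a" where
  "grad F z = (THE D. GDERIV F z :> D)"

lemma GDERIV_grad:
  assumes "F differentiable (at z)"
  shows "GDERIV F z :> grad F z"
proof -
  obtain F' where F': "(F has_derivative F') (at z)"
    using assms unfolding differentiable_def by blast
  have lin: "linear F'"
    using F' by (rule has_derivative_linear)
  have "F' = (\<lambda>v. v \<bullet> adjoint F' 1)"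
  proof
    fix v
    have "v \<bullet> adjoint F' 1 = F' v \<bullet> 1" by (rule adjoint_works[OF lin])
    then show "F' v = v \<bullet> adjoint F' 1" by simp
  qed
  with F' have D: "GDERIV F z :> adjoint F' 1"
    unfolding gderiv_def by (rule back_subst)
  have "E = adjoint F' 1" if "GDERIV F z :> E" for E
  proof -
    have "(\<lambda>v. v \<bullet> E) = (\<lambda>v. v \<bullet> adjoint F' 1)"
      using that D unfolding gderiv_def by (rule has_derivative_unique)
    then show ?thesis by (simp only: fun_eq_iff vector_eq_ldot)
  qed
  with D show ?thesis unfolding grad_def by (rule theI)
qed

definition strongly_convex :: "real \<Rightarrow> ('a::real_inner \<Rightarrow> real) \<Rightarrow> bool" where
  "strongly_convex \<mu> F \<longleftrightarrow>
     (\<forall>v w. \<forall>t\<in>{0..1}. F ((1 - t) *\<^sub>R v + t *\<^sub>R w)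
        \<le> (1 - t) * F v + t * F w - \<mu> / 2 * t * (1 - t) * (norm (v - w))\<^sup>2)"

(* At an endpoint contained in I the derivative is one-sided. *)
definition ode_solution ::
  "('a::real_normed_vector \<Rightarrow> 'a) \<Rightarrow> real set \<Rightarrow> (real \<Rightarrow> 'a) \<Rightarrow> bool" where
  "ode_solution F I \<phi> \<longleftrightarrow>
     (\<forall>t\<in>I. (\<phi> has_vector_derivative F (\<phi> t)) (at t within I))"

definition globally_asymptotically_stable ::
  "('a::real_normed_vector \<Rightarrow> 'a) \<Rightarrow> 'a \<Rightarrow> bool" where
  "globally_asymptotically_stable F z \<longleftrightarrow>
     F z = 0 \<and>
     (\<forall>z0. \<exists>\<phi>. ode_solution F {0..} \<phi> \<and> \<phi> 0 = z0) \<and>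
     (\<forall>\<epsilon>>0. \<exists>\<delta>>0. \<forall>\<phi>. ode_solution F {0..} \<phi> \<and> norm (\<phi> 0 - z) < \<delta>
        \<longrightarrow> (\<forall>t\<ge>0. norm (\<phi> t - z) < \<epsilon>)) \<and>
     (\<forall>\<phi>. ode_solution F {0..} \<phi> \<longrightarrow> (\<phi> \<longlongrightarrow> z) at_top)"

(* Uniqueness is required against solutions on every interval [0,T), so that no solution
   can escape in finite time. *)
definition globally_exponentially_stable ::
  "('a::real_normed_vector \<Rightarrow> 'a) \<Rightarrow> 'a \<Rightarrow> bool" where
  "globally_exponentially_stable F z \<longleftrightarrow>
     F z = 0 \<and>
     (\<forall>z0. \<exists>\<phi>. ode_solution F {0..} \<phi> \<and> \<phi> 0 = z0 \<and>
        (\<forall>T>0. \<forall>\<psi>. ode_solution F {0..<T} \<psi> \<and> \<psi> 0 = z0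
           \<longrightarrow> (\<forall>t\<in>{0..<T}. \<psi> t = \<phi> t))) \<and>
     (\<exists>K>0. \<exists>\<sigma>>0. \<forall>\<phi>. ode_solution F {0..} \<phi> \<longrightarrow>
        (\<forall>t\<ge>0. norm (\<phi> t - z) \<le> K * exp (- \<sigma> * t) * norm (\<phi> 0 - z)))"

definition solves_min ::
  "('u \<times> 'y \<Rightarrow> real) \<Rightarrow> ('u \<Rightarrow> 'y) \<Rightarrow> 'u \<times> 'y \<Rightarrow> bool" where
  "solves_min \<Phi> h z \<longleftrightarrow>
     snd z = h (fst z) \<and> (\<forall>u y. y = h u \<longrightarrow> \<Phi> z \<le> \<Phi> (u, y))"

(* The block matrix [I, (Jacobian of h at u)^T], acting on stacked vectors represented as pairs;
   the norm of the product type is the Euclidean norm of the stacked vector. *)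
definition H_tilde ::
  "(real^'m \<Rightarrow> real^'p) \<Rightarrow> real^'m \<Rightarrow> (real^'m) \<times> (real^'p) \<Rightarrow> real^'m" where
  "H_tilde h u z = fst z + transpose (jacobian h (at u)) *v snd z"

definition closed_loop ::
  "((real^'n) \<times> (real^'m) \<Rightarrow> real^'n) \<Rightarrow> (real^'n \<Rightarrow> real^'p) \<Rightarrow> (real^'m \<Rightarrow> real^'p) \<Rightarrow>
   ((real^'m) \<times> (real^'p) \<Rightarrow> real) \<Rightarrow> real \<Rightarrow>
   (real^'n) \<times> (real^'m) \<Rightarrow> (real^'n) \<times> (real^'m)" where
  "closed_loop f g h \<Phi> \<alpha> = (\<lambda>(x, u). (f (x, u), - \<alpha> *\<^sub>R H_tilde h u (grad \<Phi> (u, g x))))"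

end

theory Submission
  imports Defs
begin

text \<open>
  The proof rests on one quadratically bounded Lyapunov function for the interconnection. Let \<open>u0\<close> be a
  minimizer of \<open>\<Phi> (u, h u)\<close>. Stationarity says that the controller vector field vanishes at
  \<open>(u0, h u0)\<close>, so \<open>(s u0, u0)\<close> is an equilibrium of the closed loop. Freeze the second argument of
  the plant function \<open>W\<close> at \<open>u0\<close> (so that only its gradient in \<open>x\<close> enters) and put
  \<open>q = (norm (u - u0))\<^sup>2\<close>. Along the closed loop, Young's inequality gives

    \<open>(d/dt) W (x, u0) \<le> - \<mu>1 * W (x, u0) + \<theta>1 * q\<close>  (\<open>plant_dissipation\<close>),

    \<open>(d/dt) q / (2 * \<alpha>) \<le> \<theta>2 * W (x, u0) - \<mu>2 * q\<close>  (\<open>gradient_flow_dissipation\<close>),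

  the second because strong convexity makes the partial gradient of \<open>\<Phi>\<close> in \<open>u\<close> strongly monotone and
  the remaining term of the gradient disturbs this by at most \<open>l\<Phi>u\<close>. The coefficients form a matrix
  with nonnegative off-diagonal entries, and by the small-gain condition it maps the positive
  vector \<open>(1, \<xi>)\<close> to a negative one. Then so does its transpose for some positive vector \<open>(a, 1)\<close>
  (\<open>small_gain_weight\<close>), and \<open>V = a * W (x, u0) + q / (2 * \<alpha>)\<close> decays exponentially for every
  \<open>\<alpha> > 0\<close>: the gain only rescales the weight of \<open>q\<close>.

  A function \<open>V\<close> comparable to the squared distance and decaying exponentially gives global exponential
  stability (\<open>lyapunov_globally_exponentially_stable\<close>). That includes existence of solutions: a
  globally Lipschitz field has global solutions by a contraction argument, and a field that is only
  Lipschitz on compact sets can be replaced by a globally Lipschitz one outside a large ball, which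
  the decay estimate shows is never left (\<open>ode_solution_of_apriori_bound\<close>).

  Uniqueness of the minimizer comes for free: any other minimizer would yield another equilibrium of
  the closed loop, which exponential stability excludes.
\<close>

section \<open>Lipschitz continuity on compact sets\<close>

text \<open>
  On locally compact spaces this is equivalent to local Lipschitz continuity. In this form products,
  compositions and bilinear combinations need only images of compact sets to be compact, and a single
  constant is available on all of a ball or on the trace of a solution.
\<close>

definition lipschitz_on_compacts :: "('a::metric_space \<Rightarrow> 'b::metric_space) \<Rightarrow> bool" where
  "lipschitz_on_compacts F \<longleftrightarrow> (\<forall>K. compact K \<longrightarrow> (\<exists>L. L-lipschitz_on K F))"

lemma lipschitz_on_compactsE:
  assumes "lipschitz_on_compacts F" "compact K"
  obtains L where "L-lipschitz_on K F"
  using assms unfolding lipschitz_on_compacts_def by blast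

lemma locally_lipschitz_imp_lipschitz_on_compacts:
  assumes "locally_lipschitz F"
  shows "lipschitz_on_compacts F"
  unfolding lipschitz_on_compacts_def
proof (intro allI impI)
  fix K :: "'a set" assume "compact K"
  have "local_lipschitz {0::real} K (\<lambda>_. F)"
    using assms unfolding locally_lipschitz_def by (rule local_lipschitz_subset) auto
  then obtain L where "\<And>t. t \<in> {0::real} \<Longrightarrow> L-lipschitz_on K F"
    by (rule local_lipschitz_compact_implies_lipschitz[of "{0::real}" K "\<lambda>_. F"])
      (use \<open>compact K\<close> in auto)
  then show "\<exists>L. L-lipschitz_on K F" by blast
qed

lemma bounded_linear_imp_lipschitz_on_compacts:
  assumes "bounded_linear F"
  shows "lipschitz_on_compacts F"
  by (metis assms bounded_linear.lipschitz_boundE lipschitz_on_compacts_def)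

lemma lipschitz_on_compacts_imp_continuous_on:
  fixes F :: "'a::heine_borel \<Rightarrow> 'b::metric_space"
  assumes "lipschitz_on_compacts F"
  shows "continuous_on S F"
proof -
  have "isCont F x" for x
  proof -
    obtain L where "L-lipschitz_on (cball x 1) F"
      using assms compact_cball by (rule lipschitz_on_compactsE)
    then have "continuous_on (ball x 1) F"
      by (meson ball_subset_cball continuous_on_subset lipschitz_on_continuous_on)
    then show ?thesis
      by (simp add: continuous_on_eq_continuous_at)
  qed
  then show ?thesis
    by (simp add: continuous_at_imp_continuous_on)
qed

lemma lipschitz_on_compacts_compose:
  fixes F :: "'a::heine_borel \<Rightarrow> 'b::metric_space"
  assumes F: "lipschitz_on_compacts F" and G: "lipschitz_on_compacts G"
  shows "lipschitz_on_compacts (\<lambda>x. G (F x))"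
  unfolding lipschitz_on_compacts_def
proof (intro allI impI)
  fix K :: "'a set" assume K: "compact K"
  then have "compact (F ` K)"
    by (intro compact_continuous_image lipschitz_on_compacts_imp_continuous_on F)
  with K F G obtain C D where "C-lipschitz_on K F" "D-lipschitz_on (F ` K) G"
    by (meson lipschitz_on_compactsE)
  then show "\<exists>L. L-lipschitz_on K (\<lambda>x. G (F x))"
    by (blast intro: lipschitz_on_compose2)
qed

lemma lipschitz_on_compacts_Pair:
  assumes "lipschitz_on_compacts F" "lipschitz_on_compacts G"
  shows "lipschitz_on_compacts (\<lambda>x. (F x, G x))"
  using assms unfolding lipschitz_on_compacts_def by (blast intro: lipschitz_on_Pair)

lemma lipschitz_on_compacts_add:
  fixes F G :: "'a::metric_space \<Rightarrow> 'b::real_normed_vector"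
  assumes "lipschitz_on_compacts F" "lipschitz_on_compacts G"
  shows "lipschitz_on_compacts (\<lambda>x. F x + G x)"
  using assms unfolding lipschitz_on_compacts_def by (blast intro: lipschitz_on_add)

lemma lipschitz_on_compacts_scaleR:
  fixes F :: "'a::metric_space \<Rightarrow> 'b::real_normed_vector"
  assumes "lipschitz_on_compacts F"
  shows "lipschitz_on_compacts (\<lambda>x. a *\<^sub>R F x)"
  using assms unfolding lipschitz_on_compacts_def by (blast intro: lipschitz_on_cmult)

text \<open>
  The product rule \<open>B x y - B x' y' = B x (y - y') + B (x - x') y'\<close>: each factor is bounded on a compact
  set by continuity.
\<close>

lemma lipschitz_on_compacts_bilinear:
  fixes F :: "'d::heine_borel \<Rightarrow> 'a::real_normed_vector"
    and G :: "'d \<Rightarrow> 'b::real_normed_vector"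
    and B :: "'a \<Rightarrow> 'b \<Rightarrow> 'c::real_normed_vector"
  assumes B: "bounded_bilinear B"
    and F: "lipschitz_on_compacts F" and G: "lipschitz_on_compacts G"
  shows "lipschitz_on_compacts (\<lambda>x. B (F x) (G x))"
  unfolding lipschitz_on_compacts_def
proof (intro allI impI)
  fix K :: "'d set" assume K: "compact K"
  interpret bounded_bilinear B by (rule B)
  obtain N where N: "N > 0" "\<And>a b. norm (B a b) \<le> norm a * norm b * N"
    using pos_bounded by blast
  obtain C D where C: "C-lipschitz_on K F" and D: "D-lipschitz_on K G"
    using K F G by (meson lipschitz_on_compactsE)
  have "bounded (F ` K)" "bounded (G ` K)"
    by (intro compact_imp_bounded compact_continuous_image K
        lipschitz_on_compacts_imp_continuous_on F G)+
  then obtain P Q where P: "\<And>x. x \<in> K \<Longrightarrow> norm (F x) \<le> P" "P > 0"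
    and Q: "\<And>x. x \<in> K \<Longrightarrow> norm (G x) \<le> Q" "Q > 0"
    by (auto simp: bounded_pos)
  have "(P * D * N + C * Q * N)-lipschitz_on K (\<lambda>x. B (F x) (G x))"
  proof (rule lipschitz_onI)
    fix x y assume xy: "x \<in> K" "y \<in> K"
    have "B (F x) (G x) - B (F y) (G y) = B (F x) (G x - G y) + B (F x - F y) (G y)"
      by (simp add: diff_left diff_right)
    then have "norm (B (F x) (G x) - B (F y) (G y))
        \<le> norm (F x) * norm (G x - G y) * N + norm (F x - F y) * norm (G y) * N"
      by (metis N(2) norm_triangle_mono)
    also have "\<dots> \<le> P * (D * dist x y) * N + (C * dist x y) * Q * N"
      using xy P Q N(1) lipschitz_onD[OF C xy] lipschitz_onD[OF D xy]
        lipschitz_on_nonneg[OF C] lipschitz_on_nonneg[OF D]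
      by (intro add_mono mult_mono) (auto simp: dist_norm)
    finally show "dist (B (F x) (G x)) (B (F y) (G y)) \<le> (P * D * N + C * Q * N) * dist x y"
      by (simp add: dist_norm algebra_simps)
  next
    show "0 \<le> P * D * N + C * Q * N"
      using P Q N(1) lipschitz_on_nonneg[OF C] lipschitz_on_nonneg[OF D] by auto
  qed
  then show "\<exists>L. L-lipschitz_on K (\<lambda>x. B (F x) (G x))" ..
qed

section \<open>Solutions of autonomous differential equations\<close>

lemma ode_solution_subset:
  "ode_solution F I \<phi> \<Longrightarrow> J \<subseteq> I \<Longrightarrow> ode_solution F J \<phi>"
  unfolding ode_solution_def by (meson has_vector_derivative_within_subset subset_iff)

lemma ode_solution_continuous_on:
  "ode_solution F I \<phi> \<Longrightarrow> continuous_on I \<phi>"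
  unfolding ode_solution_def
  by (meson continuous_on_eq_continuous_within has_vector_derivative_continuous)

lemma ode_solution_has_derivative_interior:
  assumes "ode_solution F {0..T} \<phi>" "0 < t" "t < T"
  shows "(\<phi> has_vector_derivative F (\<phi> t)) (at t)"
proof -
  have "(\<phi> has_vector_derivative F (\<phi> t)) (at t within {0..T})"
    using assms unfolding ode_solution_def by auto
  moreover have "at t within {0..T} = at t"
    using assms by (intro at_within_interior) auto
  ultimately show ?thesis by simp
qed

text \<open>
  The differential form of Gronwall's inequality: \<open>exp (- k * t) * v t\<close> does not increase. The
  derivative is required only at interior times, so that one-sided derivatives at the ends of the
  interval of a solution do no harm; \<open>k\<close> may have either sign, which serves both uniqueness and decay.
\<close>

lemma exponential_bound:
  fixes v v' :: "real \<Rightarrow> real"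
  assumes "0 \<le> T" and cont: "continuous_on {0..T} v"
    and deriv: "\<And>t. 0 < t \<Longrightarrow> t < T \<Longrightarrow> (v has_real_derivative v' t) (at t)"
    and le: "\<And>t. 0 < t \<Longrightarrow> t < T \<Longrightarrow> v' t \<le> k * v t"
  shows "v T \<le> exp (k * T) * v 0"
proof -
  have "exp (- k * T) * v T \<le> exp (- k * 0) * v 0"
  proof (rule DERIV_nonpos_imp_decreasing_open[OF \<open>0 \<le> T\<close>, of "\<lambda>t. exp (- k * t) * v t"])
    fix t assume t: "0 < t" "t < T"
    have "((\<lambda>t. exp (- k * t) * v t) has_real_derivative exp (- k * t) * (v' t - k * v t)) (at t)"
      by (rule derivative_eq_intros deriv t refl | simp add: algebra_simps)+
    moreover have "exp (- k * t) * (v' t - k * v t) \<le> 0"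
      using le[OF t] by (simp add: mult_nonneg_nonpos)
    ultimately show "\<exists>y. ((\<lambda>t. exp (- k * t) * v t) has_real_derivative y) (at t) \<and> y \<le> 0"
      by blast
  next
    show "continuous_on {0..T} (\<lambda>t. exp (- k * t) * v t)"
      by (intro continuous_intros cont)
  qed
  then have "exp (k * T) * (exp (- k * T) * v T) \<le> exp (k * T) * v 0"
    by simp
  then show ?thesis
    by (simp add: mult.assoc[symmetric] exp_add[symmetric])
qed

text \<open>
  On the compact union of the two traces the field has one Lipschitz constant \<open>L\<close>, so the squared distance
  of the solutions grows at most at rate \<open>2 * L\<close>, starting from zero.
\<close>

lemma ode_solution_unique:
  fixes F :: "'a::real_inner \<Rightarrow> 'a"
  assumes F: "lipschitz_on_compacts F"
    and \<phi>: "ode_solution F {0..T} \<phi>" and \<psi>: "ode_solution F {0..T} \<psi>"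
    and init: "\<phi> 0 = \<psi> 0" and T: "0 \<le> T"
  shows "\<phi> T = \<psi> T"
proof -
  note cont = ode_solution_continuous_on[OF \<phi>] ode_solution_continuous_on[OF \<psi>]
  have "compact (\<phi> ` {0..T} \<union> \<psi> ` {0..T})"
    by (intro compact_Un compact_continuous_image cont compact_Icc)
  then obtain L where L: "L-lipschitz_on (\<phi> ` {0..T} \<union> \<psi> ` {0..T}) F"
    using F lipschitz_on_compactsE by blast
  define v where "v t = (norm (\<phi> t - \<psi> t))\<^sup>2" for t
  have "v T \<le> exp (2 * L * T) * v 0"
  proof (rule exponential_bound[where v' = "\<lambda>t. 2 * ((\<phi> t - \<psi> t) \<bullet> (F (\<phi> t) - F (\<psi> t)))"])
    show "continuous_on {0..T} v"
      unfolding v_def by (intro continuous_intros cont)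
  next
    fix t assume t: "0 < t" "t < T"
    note d = ode_solution_has_derivative_interior[OF \<phi> t, unfolded has_vector_derivative_def]
      ode_solution_has_derivative_interior[OF \<psi> t, unfolded has_vector_derivative_def]
    show "(v has_real_derivative 2 * ((\<phi> t - \<psi> t) \<bullet> (F (\<phi> t) - F (\<psi> t)))) (at t)"
      unfolding v_def power2_norm_eq_inner has_field_derivative_def
      by (rule derivative_eq_intros d refl | simp add: algebra_simps inner_commute fun_eq_iff)+
    have "(\<phi> t - \<psi> t) \<bullet> (F (\<phi> t) - F (\<psi> t)) \<le> norm (\<phi> t - \<psi> t) * (L * norm (\<phi> t - \<psi> t))"
    proof (rule order_trans[OF norm_cauchy_schwarz mult_left_mono])
      show "norm (F (\<phi> t) - F (\<psi> t)) \<le> L * norm (\<phi> t - \<psi> t)"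
        using t by (intro lipschitz_on_normD[OF L]) auto
    qed simp
    then show "2 * ((\<phi> t - \<psi> t) \<bullet> (F (\<phi> t) - F (\<psi> t))) \<le> 2 * L * v t"
      unfolding v_def by (simp add: power2_eq_square algebra_simps)
  qed (rule T)
  then show ?thesis
    by (simp add: v_def init)
qed

lemma indefinite_integral_has_vector_derivative:
  fixes f :: "real \<Rightarrow> 'a::banach"
  assumes "continuous_on {0..} f" "0 \<le> t"
  shows "((\<lambda>t. integral {0..t} f) has_vector_derivative f t) (at t within {0..})"
proof -
  have "((\<lambda>t. integral {0..t} f) has_vector_derivative f t) (at t within {0..t+1})"
    by (rule integral_has_vector_derivative) (use assms in \<open>auto intro: continuous_on_subset\<close>)
  moreover have "at t within {0..t+1} = at t within {0..}"
    by (rule at_within_nhd[of t "{..<t+1}"]) auto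
  ultimately show ?thesis by simp
qed

text \<open>
  The Picard operator is a contraction on all of \<open>{0..}\<close> at once when curves are compared in the norm
  weighted by \<open>exp (- \<gamma> * t)\<close> with \<open>\<gamma> > L\<close> (Bielecki), so local solutions need not be glued together. The
  fixed point is sought among bounded continuous functions \<open>\<psi>\<close>, with the curve recovered as
  \<open>exp (\<gamma> * t) *\<^sub>R \<psi> t\<close>; negative times are collapsed to \<open>0\<close> because these functions live on the whole line.
\<close>

lemma ode_solution_global_lipschitz:
  fixes F :: "'a::banach \<Rightarrow> 'a"
  assumes F: "L-lipschitz_on UNIV F"
  shows "\<exists>\<phi>. ode_solution F {0..} \<phi> \<and> \<phi> 0 = z0"
proof -
  \<comment> \<open>Any exponent above \<open>L\<close> makes \<open>L / \<gamma>\<close> less than one; this choice also covers \<open>L = 0\<close>.\<close>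
  define \<gamma> where "\<gamma> = L + 1"
  have L: "L \<ge> 0" and \<gamma>: "\<gamma> > 0" using lipschitz_on_nonneg[OF F] by (auto simp: \<gamma>_def)
  have contF: "continuous_on S F" for S
    using lipschitz_on_continuous_on[OF F] continuous_on_subset by blast
  define J where "J \<psi> t = integral {0..t} (\<lambda>s. F (exp (\<gamma> * s) *\<^sub>R apply_bcontfun \<psi> s))"
    for \<psi> :: "real \<Rightarrow>\<^sub>C 'a" and t
  have contI: "continuous_on S (\<lambda>s. F (exp (\<gamma> * s) *\<^sub>R apply_bcontfun \<psi> s))" for S \<psi>
    by (intro continuous_on_compose2[OF contF[of UNIV]] continuous_intros) auto
  have J': "(J \<psi> has_vector_derivative F (exp (\<gamma> * t) *\<^sub>R apply_bcontfun \<psi> t))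
      (at t within {0..})" if "t \<ge> 0" for \<psi> t
    unfolding J_def by (rule indefinite_integral_has_vector_derivative[OF contI that])
  have contJ: "continuous_on {0..} (J \<psi>)" for \<psi>
    unfolding continuous_on_eq_continuous_within
    using J' has_vector_derivative_continuous by force
  have exp_integral: "((\<lambda>s. c * exp (\<gamma> * s)) has_integral c * (exp (\<gamma> * t) - 1) / \<gamma>) {0..t}"
    if "t \<ge> 0" for c t
  proof -
    have "((\<lambda>s. c * exp (\<gamma> * s)) has_integral c * exp (\<gamma> * t) / \<gamma> - c * exp (\<gamma> * 0) / \<gamma>) {0..t}"
      using that \<gamma>
      by (intro fundamental_theorem_of_calculus)
        (auto intro!: derivative_eq_intros simp flip: has_real_derivative_iff_has_vector_derivative)
    then show ?thesis by (simp add: diff_divide_distrib right_diff_distrib)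
  qed
  \<comment> \<open>This bound shows both that the operator preserves boundedness (\<open>c\<close> from the growth of \<open>F\<close>) and that
    it contracts (\<open>c = L * dist\<close>).\<close>
  have weighted: "exp (- \<gamma> * t) * norm (integral {0..t} G) \<le> c / \<gamma>"
    if "t \<ge> 0" "c \<ge> 0" "continuous_on {0..t} G" "\<And>s. s \<in> {0..t} \<Longrightarrow> norm (G s) \<le> c * exp (\<gamma> * s)"
    for G :: "real \<Rightarrow> 'a" and c t
  proof -
    have "norm (integral {0..t} G) \<le> integral {0..t} (\<lambda>s. c * exp (\<gamma> * s))"
      by (rule integral_norm_bound_integral)
        (use that exp_integral[OF that(1), of c] in \<open>auto intro: integrable_continuous_real\<close>)
    also have "\<dots> = c * (exp (\<gamma> * t) - 1) / \<gamma>"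
      using exp_integral[OF that(1)] by (rule integral_unique)
    also have "\<dots> \<le> c * exp (\<gamma> * t) / \<gamma>"
      using \<gamma> that by (intro divide_right_mono mult_left_mono) auto
    finally have "exp (- \<gamma> * t) * norm (integral {0..t} G)
        \<le> exp (- \<gamma> * t) * (c * exp (\<gamma> * t) / \<gamma>)"
      by (intro mult_left_mono) auto
    also have "\<dots> = c / \<gamma>"
      by (simp add: exp_minus field_simps)
    finally show ?thesis .
  qed
  define P where "P \<psi> t = exp (- \<gamma> * max 0 t) *\<^sub>R (z0 + J \<psi> (max 0 t))" for \<psi> t
  have P_bcontfun: "P \<psi> \<in> bcontfun" for \<psi>
  proof (rule bcontfun_normI)
    show "continuous_on UNIV (P \<psi>)"
      unfolding P_def
      by (intro continuous_intros continuous_on_compose2[OF contJ]) auto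
    fix t :: real
    define r where "r = max 0 t"
    have r: "r \<ge> 0" by (simp add: r_def)
    have "norm (F (exp (\<gamma> * s) *\<^sub>R apply_bcontfun \<psi> s)) \<le> (norm (F 0) + L * norm \<psi>) * exp (\<gamma> * s)"
      if "s \<ge> 0" for s
    proof -
      have "norm (F (exp (\<gamma> * s) *\<^sub>R apply_bcontfun \<psi> s) - F 0) \<le> L * (exp (\<gamma> * s) * norm (apply_bcontfun \<psi> s))"
        using lipschitz_on_normD[OF F, of "exp (\<gamma> * s) *\<^sub>R apply_bcontfun \<psi> s" 0] by simp
      also have "\<dots> \<le> L * (exp (\<gamma> * s) * norm \<psi>)"
        using L norm_bounded[of \<psi> s] by (intro mult_left_mono) auto
      finally have "norm (F (exp (\<gamma> * s) *\<^sub>R apply_bcontfun \<psi> s)) \<le> norm (F 0) * 1 + L * (exp (\<gamma> * s) * norm \<psi>)"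
        using norm_triangle_sub[of "F (exp (\<gamma> * s) *\<^sub>R apply_bcontfun \<psi> s)" "F 0"] by linarith
      also have "\<dots> \<le> norm (F 0) * exp (\<gamma> * s) + L * (exp (\<gamma> * s) * norm \<psi>)"
        using \<gamma> that by (intro add_right_mono mult_left_mono) auto
      finally show ?thesis by (simp add: algebra_simps)
    qed
    then have "exp (- \<gamma> * r) * norm (J \<psi> r) \<le> (norm (F 0) + L * norm \<psi>) / \<gamma>"
      unfolding J_def using L r by (intro weighted contI) auto
    moreover have "exp (- \<gamma> * r) * norm z0 \<le> 1 * norm z0"
      using \<gamma> r by (intro mult_right_mono) auto
    moreover have "norm (P \<psi> t) \<le> exp (- \<gamma> * r) * norm z0 + exp (- \<gamma> * r) * norm (J \<psi> r)"
      unfolding P_def r_def[symmetric] by (simp flip: distrib_left add: norm_triangle_ineq)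
    ultimately show "norm (P \<psi> t) \<le> norm z0 + (norm (F 0) + L * norm \<psi>) / \<gamma>"
      by linarith
  qed
  have contraction: "dist (Bcontfun (P \<psi>)) (Bcontfun (P \<eta>)) \<le> L / \<gamma> * dist \<psi> \<eta>" for \<psi> \<eta>
  proof (rule dist_bound)
    fix t :: real
    define r where "r = max 0 t"
    have r: "r \<ge> 0" by (simp add: r_def)
    have "exp (- \<gamma> * r) * norm (integral {0..r} (\<lambda>s. F (exp (\<gamma> * s) *\<^sub>R apply_bcontfun \<psi> s)
        - F (exp (\<gamma> * s) *\<^sub>R apply_bcontfun \<eta> s))) \<le> (L * dist \<psi> \<eta>) / \<gamma>"
    proof (intro weighted contI continuous_intros)
      fix s :: real
      have "norm (F (exp (\<gamma> * s) *\<^sub>R apply_bcontfun \<psi> s) - F (exp (\<gamma> * s) *\<^sub>R apply_bcontfun \<eta> s))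
          \<le> L * (exp (\<gamma> * s) * dist (apply_bcontfun \<psi> s) (apply_bcontfun \<eta> s))"
        using lipschitz_on_normD[OF F, of "exp (\<gamma> * s) *\<^sub>R apply_bcontfun \<psi> s" "exp (\<gamma> * s) *\<^sub>R apply_bcontfun \<eta> s"]
        by (simp add: dist_norm flip: scaleR_diff_right)
      also have "\<dots> \<le> L * (exp (\<gamma> * s) * dist \<psi> \<eta>)"
        using L dist_bounded by (intro mult_left_mono) auto
      finally show "norm (F (exp (\<gamma> * s) *\<^sub>R apply_bcontfun \<psi> s) - F (exp (\<gamma> * s) *\<^sub>R apply_bcontfun \<eta> s))
          \<le> L * dist \<psi> \<eta> * exp (\<gamma> * s)"
        by (simp add: algebra_simps)
    qed (use r L in auto)
    also have "integral {0..r} (\<lambda>s. F (exp (\<gamma> * s) *\<^sub>R apply_bcontfun \<psi> s)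
        - F (exp (\<gamma> * s) *\<^sub>R apply_bcontfun \<eta> s)) = J \<psi> r - J \<eta> r"
      unfolding J_def by (intro integral_diff integrable_continuous_real contI)
    finally show "dist (apply_bcontfun (Bcontfun (P \<psi>)) t) (apply_bcontfun (Bcontfun (P \<eta>)) t) \<le> L / \<gamma> * dist \<psi> \<eta>"
      by (simp add: Bcontfun_inverse P_bcontfun P_def r_def[symmetric] dist_norm
          flip: scaleR_diff_right)
  qed
  obtain \<psi> where "Bcontfun (P \<psi>) = \<psi>"
    using banach_fix_type[of "L / \<gamma>" "\<lambda>\<psi>. Bcontfun (P \<psi>)"] contraction L \<gamma>
    by (auto simp: \<gamma>_def)
  then have fixpoint: "apply_bcontfun \<psi> t = P \<psi> t" for t
    by (metis Bcontfun_inverse P_bcontfun)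
  define \<phi> where "\<phi> t = z0 + J \<psi> t" for t
  have \<phi>: "exp (\<gamma> * t) *\<^sub>R apply_bcontfun \<psi> t = \<phi> t" if "t \<ge> 0" for t
    using that by (simp add: fixpoint P_def \<phi>_def flip: exp_add)
  have "ode_solution F {0..} \<phi>"
    unfolding ode_solution_def
  proof
    fix t :: real assume "t \<in> {0..}"
    then have t: "t \<ge> 0" by simp
    have "((\<lambda>t. z0 + J \<psi> t) has_vector_derivative 0 + F (\<phi> t)) (at t within {0..})"
      using J'[OF t, of \<psi>] unfolding \<phi>[OF t]
      by (intro has_vector_derivative_add has_vector_derivative_const)
    then show "(\<phi> has_vector_derivative F (\<phi> t)) (at t within {0..})"
      by (simp add: \<phi>_def[abs_def])
  qed
  moreover have "\<phi> 0 = z0"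
    by (simp add: \<phi>_def J_def)
  ultimately show ?thesis by blast
qed

text \<open>
  Composing the field with the nearest-point projection onto \<open>cball z R\<close> gives a globally Lipschitz field
  that agrees with the original one on the ball. Its solution cannot reach the sphere, since up to
  that moment it solves the original equation and is subject to the bound.
\<close>

lemma ode_solution_of_apriori_bound:
  fixes F :: "'a::euclidean_space \<Rightarrow> 'a"
  assumes F: "lipschitz_on_compacts F"
    and bound: "\<And>T \<psi>. 0 \<le> T \<Longrightarrow> ode_solution F {0..T} \<psi> \<Longrightarrow> \<psi> 0 = z0 \<Longrightarrow> norm (\<psi> T - z) < R"
  shows "\<exists>\<phi>. ode_solution F {0..} \<phi> \<and> \<phi> 0 = z0"
proof -
  define B where "B = cball z R"
  \<comment> \<open>At \<open>T = 0\<close> the bound says that the initial value lies inside the ball.\<close>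
  have "ode_solution F {0..0} (\<lambda>_. z0)"
    by (simp add: ode_solution_def has_vector_derivative_def has_derivative_within_singleton_iff
        bounded_linear_scaleR_left)
  then have z0: "norm (z0 - z) < R"
    using bound[of 0 "\<lambda>_. z0"] by simp
  then have "R > 0"
    using norm_ge_zero[of "z0 - z"] by linarith
  then have B: "convex B" "closed B" "B \<noteq> {}" "compact B"
    by (auto simp: B_def dist_norm norm_minus_commute)
  obtain L where L: "L-lipschitz_on B F"
    using F B(4) by (rule lipschitz_on_compactsE)
  have "1-lipschitz_on UNIV (closest_point B)"
    using closest_point_lipschitz[OF B(1-3)] by (intro lipschitz_onI) auto
  moreover have "L-lipschitz_on (closest_point B ` UNIV) F"
    using L by (rule lipschitz_on_subset) (use B closest_point_in_set in blast)
  ultimately have "(L * 1)-lipschitz_on UNIV (\<lambda>x. F (closest_point B x))"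
    by (rule lipschitz_on_compose2)
  then obtain \<phi> where \<phi>: "ode_solution (\<lambda>x. F (closest_point B x)) {0..} \<phi>" "\<phi> 0 = z0"
    using ode_solution_global_lipschitz by blast
  have agree: "ode_solution F I \<phi>" if "I \<subseteq> {0..}" "\<And>t. t \<in> I \<Longrightarrow> norm (\<phi> t - z) \<le> R" for I
    using ode_solution_subset[OF \<phi>(1) that(1)] that(2)
    by (simp add: ode_solution_def closest_point_self B_def dist_norm norm_minus_commute)
  have cont: "continuous_on {0..b} (\<lambda>t. norm (\<phi> t - z))" for b
    using ode_solution_continuous_on[OF ode_solution_subset[OF \<phi>(1)]]
    by (intro continuous_intros) auto
  have "norm (\<phi> t - z) < R" if "t \<ge> 0" for t
  proof (rule ccontr)
    \<comment> \<open>At the first time on the boundary sphere the curve has so far been a solution of the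
      original equation, to which the a priori bound applies.\<close>
    define S where "S = {r \<in> {0..t}. norm (\<phi> r - z) = R}"
    assume "\<not> norm (\<phi> t - z) < R"
    then have "S \<noteq> {}"
      using IVT'[OF _ _ \<open>t \<ge> 0\<close> cont, of R] z0 \<phi>(2) by (auto simp: S_def)
    moreover have "compact S"
    proof -
      have "closed S"
        unfolding S_def using continuous_closed_preimage_constant[OF cont[of t] closed_atLeastAtMost] by simp
      then have "compact (S \<inter> {0..t})"
        by (rule closed_Int_compact) simp
      moreover have "S \<inter> {0..t} = S"
        by (auto simp: S_def)
      ultimately show ?thesis by simp
    qed
    ultimately obtain \<tau> where \<tau>: "\<tau> \<in> S" "\<forall>s\<in>S. \<tau> \<le> s"
      by (meson compact_attains_inf)
    have "norm (\<phi> s - z) \<le> R" if "s \<in> {0..\<tau>}" for s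
    proof (rule ccontr)
      assume *: "\<not> norm (\<phi> s - z) \<le> R"
      then obtain r where "0 \<le> r" "r \<le> s" "norm (\<phi> r - z) = R"
        using IVT'[of "\<lambda>t. norm (\<phi> t - z)" 0 R s] cont[of s] z0 \<phi>(2) \<open>s \<in> {0..\<tau>}\<close> by auto
      moreover from this that \<tau>(1) have "r \<in> S"
        by (auto simp: S_def)
      ultimately have "s = r"
        using that \<tau>(2) by force
      with * \<open>norm (\<phi> r - z) = R\<close> show False by simp
    qed
    then have "ode_solution F {0..\<tau>} \<phi>"
      by (intro agree) auto
    then have "norm (\<phi> \<tau> - z) < R"
      using \<tau>(1) \<phi>(2) by (intro bound) (auto simp: S_def)
    with \<tau>(1) show False by (simp add: S_def)
  qed
  then have "ode_solution F {0..} \<phi>"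
    by (intro agree) (auto intro: less_imp_le)
  with \<phi>(2) show ?thesis by blast
qed

section \<open>Exponential stability from a Lyapunov function\<close>

lemma lyapunov_exponential_decay:
  fixes F :: "'a::real_inner \<Rightarrow> 'a"
  assumes V: "\<And>w. (V has_derivative V' w) (at w)"
    and decrease: "\<And>w. V' w (F w) \<le> - k * V w"
    and \<phi>: "ode_solution F {0..T} \<phi>" and T: "0 \<le> T"
  shows "V (\<phi> T) \<le> exp (- k * T) * V (\<phi> 0)"
proof (rule exponential_bound[OF T, where v = "\<lambda>t. V (\<phi> t)" and v' = "\<lambda>t. V' (\<phi> t) (F (\<phi> t))"])
  have "continuous_on UNIV V"
    using V by (intro has_derivative_continuous_on) (auto intro: has_derivative_at_withinI)
  then show "continuous_on {0..T} (\<lambda>t. V (\<phi> t))"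
    by (rule continuous_on_compose2[OF _ ode_solution_continuous_on[OF \<phi>]]) auto
next
  fix t assume t: "0 < t" "t < T"
  have "((\<lambda>t. V (\<phi> t)) has_derivative (\<lambda>x. V' (\<phi> t) (x *\<^sub>R F (\<phi> t)))) (at t)"
    using ode_solution_has_derivative_interior[OF \<phi> t] V[of "\<phi> t"]
    unfolding has_vector_derivative_def by (rule has_derivative_compose)
  then show "((\<lambda>t. V (\<phi> t)) has_real_derivative V' (\<phi> t) (F (\<phi> t))) (at t)"
    using has_derivative_linear[OF V[of "\<phi> t"]]
    by (simp add: has_field_derivative_def linear_scale mult_commute_abs)
  show "V' (\<phi> t) (F (\<phi> t)) \<le> - k * V (\<phi> t)"
    by (rule decrease)
qed

text \<open>
  Lyapunov's direct method. The same decay estimate has two uses: as the stability estimate, and, since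
  it confines solutions on every bounded interval to a ball depending only on the initial value, as the
  a priori bound that yields global existence.
\<close>

theorem lyapunov_globally_exponentially_stable:
  fixes F :: "'a::euclidean_space \<Rightarrow> 'a"
  assumes F: "lipschitz_on_compacts F" and equilibrium: "F z = 0"
    and pos: "c > 0" "d > 0" "k > 0"
    and lower: "\<And>w. c * (norm (w - z))\<^sup>2 \<le> V w" and upper: "\<And>w. V w \<le> d * (norm (w - z))\<^sup>2"
    and V: "\<And>w. (V has_derivative V' w) (at w)"
    and decrease: "\<And>w. V' w (F w) \<le> - k * V w"
  shows "globally_exponentially_stable F z"
proof -
  define K where "K = sqrt (d / c)"
  have K: "K > 0" using pos by (simp add: K_def)
  have decay: "norm (\<phi> T - z) \<le> K * exp (- (k / 2) * T) * norm (\<phi> 0 - z)"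
    if "ode_solution F {0..T} \<phi>" "0 \<le> T" for \<phi> T
  proof (rule power2_le_imp_le)
    have "c * (norm (\<phi> T - z))\<^sup>2 \<le> exp (- k * T) * V (\<phi> 0)"
      using lower lyapunov_exponential_decay[OF V decrease that] by (rule order_trans)
    also have "\<dots> \<le> exp (- k * T) * (d * (norm (\<phi> 0 - z))\<^sup>2)"
      by (intro mult_left_mono upper) auto
    finally have "(norm (\<phi> T - z))\<^sup>2 \<le> d / c * exp (- k * T) * (norm (\<phi> 0 - z))\<^sup>2"
      using pos by (simp add: field_simps)
    also have "\<dots> = (K * exp (- (k / 2) * T) * norm (\<phi> 0 - z))\<^sup>2"
      using pos by (simp add: K_def power_mult_distrib flip: exp_double)
    finally show "(norm (\<phi> T - z))\<^sup>2 \<le> (K * exp (- (k / 2) * T) * norm (\<phi> 0 - z))\<^sup>2" .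
  qed (use K in simp)
  have "\<exists>\<phi>. ode_solution F {0..} \<phi> \<and> \<phi> 0 = z0 \<and>
      (\<forall>T>0. \<forall>\<psi>. ode_solution F {0..<T} \<psi> \<and> \<psi> 0 = z0 \<longrightarrow> (\<forall>t\<in>{0..<T}. \<psi> t = \<phi> t))" for z0
  proof -
    have "norm (\<psi> T - z) < K * norm (z0 - z) + 1"
      if "0 \<le> T" "ode_solution F {0..T} \<psi>" "\<psi> 0 = z0" for T \<psi>
    proof -
      have "K * exp (- (k / 2) * T) * norm (z0 - z) \<le> K * 1 * norm (z0 - z)"
        using K pos that(1) by (intro mult_right_mono mult_left_mono) auto
      with decay[OF that(2,1)] that(3) show ?thesis by simp
    qed
    then obtain \<phi> where \<phi>: "ode_solution F {0..} \<phi>" "\<phi> 0 = z0"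
      using ode_solution_of_apriori_bound[OF F] by blast
    moreover have "\<psi> t = \<phi> t" if "ode_solution F {0..<T} \<psi>" "\<psi> 0 = z0" "t \<in> {0..<T}" for T \<psi> t
      by (rule ode_solution_unique[OF F])
        (use that \<phi> in \<open>auto elim!: ode_solution_subset\<close>)
    ultimately show ?thesis by blast
  qed
  moreover have "norm (\<phi> t - z) \<le> K * exp (- (k / 2) * t) * norm (\<phi> 0 - z)"
    if "ode_solution F {0..} \<phi>" "t \<ge> 0" for \<phi> t
    using that by (intro decay) (auto elim: ode_solution_subset)
  moreover have "k / 2 > 0" using pos by simp
  ultimately show ?thesis
    unfolding globally_exponentially_stable_def using equilibrium K by blast
qed

lemma globally_exponentially_stable_tendsto:
  assumes "globally_exponentially_stable F z" "ode_solution F {0..} \<phi>"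
  shows "(\<phi> \<longlongrightarrow> z) at_top"
proof -
  have "\<exists>K>0. \<exists>\<sigma>>0. \<forall>\<phi>. ode_solution F {0..} \<phi> \<longrightarrow>
      (\<forall>t\<ge>0. norm (\<phi> t - z) \<le> K * exp (- \<sigma> * t) * norm (\<phi> 0 - z))"
    using assms(1) unfolding globally_exponentially_stable_def by (elim conjE)
  then obtain K \<sigma>
    where K: "\<sigma> > 0" "\<forall>t\<ge>0. norm (\<phi> t - z) \<le> K * exp (- \<sigma> * t) * norm (\<phi> 0 - z)"
    using assms(2) by metis
  have "filterlim (\<lambda>t. \<sigma> * t) at_top at_top"
    using K(1) by (intro filterlim_tendsto_pos_mult_at_top[OF tendsto_const] filterlim_ident)
  then have "((\<lambda>t. exp (- (\<sigma> * t))) \<longlongrightarrow> 0) at_top"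
    by (intro filterlim_compose[OF exp_at_bot] filterlim_compose[OF filterlim_uminus_at_bot_at_top])
  then have "((\<lambda>t. K * exp (- \<sigma> * t) * norm (\<phi> 0 - z)) \<longlongrightarrow> 0) at_top"
    by (intro tendsto_mult_left_zero tendsto_mult_right_zero) simp
  then have "((\<lambda>t. \<phi> t - z) \<longlongrightarrow> 0) at_top"
    by (rule Lim_null_comparison[rotated]) (use K(2) in \<open>auto simp: eventually_at_top_linorder\<close>)
  then show ?thesis by (simp add: LIM_zero_iff)
qed

text \<open>
  A second equilibrium would be a constant solution that does not converge to the first.
\<close>

lemma globally_exponentially_stable_unique_equilibrium:
  assumes "globally_exponentially_stable F z" "F w = 0"
  shows "w = z"
proof -
  have "ode_solution F {0..} (\<lambda>_. w)"
    using assms(2) by (simp add: ode_solution_def)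
  then have "((\<lambda>_::real. w) \<longlongrightarrow> z) at_top"
    by (rule globally_exponentially_stable_tendsto[OF assms(1)])
  then show ?thesis
    by (simp add: tendsto_const_iff)
qed

section \<open>Strong convexity and stationarity\<close>

text \<open>
  Divide the convexity inequality on the segment from \<open>v\<close> to \<open>w\<close> by the parameter \<open>t\<close> and let \<open>t\<close> tend
  to \<open>0\<close> from the right: the difference quotient becomes the directional derivative.
\<close>

lemma strongly_convex_first_order:
  assumes F: "strongly_convex \<mu> F" and D: "GDERIV F v :> D"
  shows "F v + (w - v) \<bullet> D + \<mu> / 2 * (norm (w - v))\<^sup>2 \<le> F w"
proof -
  have line: "((\<lambda>t. v + t *\<^sub>R (w - v)) has_derivative (\<lambda>t. t *\<^sub>R (w - v))) (at 0)"
    by (auto intro!: derivative_eq_intros)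
  have "(F has_derivative (\<lambda>x. x \<bullet> D)) (at (v + 0 *\<^sub>R (w - v)))"
    using D by (simp add: gderiv_def)
  from has_derivative_compose[OF line this]
  have "((\<lambda>t. F (v + t *\<^sub>R (w - v))) has_real_derivative (w - v) \<bullet> D) (at 0)"
    by (simp add: has_field_derivative_def mult_commute_abs)
  then have "((\<lambda>t. (F (v + t *\<^sub>R (w - v)) - F v) / t) \<longlongrightarrow> (w - v) \<bullet> D) (at 0)"
    by (simp add: DERIV_def)
  then have quotient: "((\<lambda>t. (F (v + t *\<^sub>R (w - v)) - F v) / t) \<longlongrightarrow> (w - v) \<bullet> D) (at_right 0)"
    by (rule filterlim_mono[OF _ order_refl at_le]) auto
  have "((\<lambda>t. F w - F v - \<mu> / 2 * (1 - t) * (norm (w - v))\<^sup>2)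
      \<longlongrightarrow> F w - F v - \<mu> / 2 * (1 - 0) * (norm (w - v))\<^sup>2) (at_right 0)"
    by (intro tendsto_intros)
  moreover have "\<forall>\<^sub>F t in at_right 0. (F (v + t *\<^sub>R (w - v)) - F v) / t
      \<le> F w - F v - \<mu> / 2 * (1 - t) * (norm (w - v))\<^sup>2"
  proof (rule eventually_at_rightI[of 0 1])
    fix t :: real assume t: "t \<in> {0<..<1}"
    have "F ((1 - t) *\<^sub>R v + t *\<^sub>R w) \<le> (1 - t) * F v + t * F w - \<mu> / 2 * t * (1 - t) * (norm (v - w))\<^sup>2"
      using F t unfolding strongly_convex_def by auto
    moreover have "(1 - t) *\<^sub>R v + t *\<^sub>R w = v + t *\<^sub>R (w - v)"
      by (simp add: algebra_simps)
    ultimately have "F (v + t *\<^sub>R (w - v)) - F v \<le> (F w - F v - \<mu> / 2 * (1 - t) * (norm (w - v))\<^sup>2) * t"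
      by (simp add: norm_minus_commute algebra_simps)
    then show "(F (v + t *\<^sub>R (w - v)) - F v) / t \<le> F w - F v - \<mu> / 2 * (1 - t) * (norm (w - v))\<^sup>2"
      using t by (simp add: pos_divide_le_eq)
  qed simp
  ultimately have "(w - v) \<bullet> D \<le> F w - F v - \<mu> / 2 * (1 - 0) * (norm (w - v))\<^sup>2"
    using quotient by (intro tendsto_le[of "at_right (0::real)"]) auto
  then show ?thesis by simp
qed

lemma strongly_convex_gradient_monotone:
  assumes F: "strongly_convex \<mu> F" and "GDERIV F v :> D" "GDERIV F w :> E"
  shows "\<mu> * (norm (v - w))\<^sup>2 \<le> (v - w) \<bullet> (D - E)"
  using strongly_convex_first_order[OF F assms(2), of w]
    strongly_convex_first_order[OF F assms(3), of v]
  by (simp add: norm_minus_commute algebra_simps)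

lemma GDERIV_partial_fst:
  assumes "\<Phi> differentiable (at (u, y))"
  shows "GDERIV (\<lambda>u. \<Phi> (u, y)) u :> fst (grad \<Phi> (u, y))"
proof -
  have "((\<lambda>u. (u, y)) has_derivative (\<lambda>v. (v, 0))) (at u)"
    by (auto intro!: derivative_eq_intros)
  from has_derivative_compose[OF this GDERIV_grad[OF assms, unfolded gderiv_def]]
  show ?thesis
    by (simp add: gderiv_def inner_prod_def)
qed

text \<open>
  The chain rule: \<open>H_tilde\<close> is what turns the gradient of \<open>\<Phi>\<close> into the gradient of the cost with the
  steady-state output eliminated.
\<close>

lemma GDERIV_reduced_cost:
  assumes \<Phi>: "\<Phi> differentiable (at (u, h u))" and h: "h differentiable (at u)"
  shows "GDERIV (\<lambda>u. \<Phi> (u, h u)) u :> H_tilde h u (grad \<Phi> (u, h u))"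
proof -
  have "((\<lambda>u. (u, h u)) has_derivative (\<lambda>v. (v, jacobian h (at u) *v v))) (at u)"
    using jacobian_works[THEN iffD1, OF h] by (auto intro!: derivative_eq_intros)
  note has_derivative_compose[OF this GDERIV_grad[OF \<Phi>, unfolded gderiv_def]]
  moreover have "(jacobian h (at u) *v v) \<bullet> r = v \<bullet> (transpose (jacobian h (at u)) *v r)" for v r
    by (metis dot_lmul_matrix inner_commute transpose_matrix_vector)
  ultimately show ?thesis
    by (simp add: gderiv_def inner_prod_def H_tilde_def inner_add_right del: transpose_matrix_vector)
qed

lemma solves_min_stationary:
  assumes "solves_min \<Phi> h (u, y)"
    and \<Phi>: "\<Phi> differentiable (at (u, h u))" and h: "h differentiable (at u)"
  shows "y = h u" "H_tilde h u (grad \<Phi> (u, h u)) = 0"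
proof -
  show "y = h u"
    using assms(1) by (simp add: solves_min_def)
  with assms(1) have "\<forall>v\<in>UNIV. \<Phi> (u, h u) \<le> \<Phi> (v, h v)"
    by (simp add: solves_min_def)
  then have "(\<lambda>v. v \<bullet> H_tilde h u (grad \<Phi> (u, h u))) = (\<lambda>v. 0)"
    using GDERIV_reduced_cost[OF \<Phi> h] unfolding gderiv_def
    by (intro differential_zero_maxmin[OF UNIV_I open_UNIV]) auto
  then show "H_tilde h u (grad \<Phi> (u, h u)) = 0"
    by (metis inner_eq_zero_iff)
qed

section \<open>The interconnection of plant and gradient flow\<close>

lemma young_inequality:
  fixes p q \<epsilon> :: real
  assumes "\<epsilon> > 0"
  shows "p * q \<le> \<epsilon> / 2 * p\<^sup>2 + q\<^sup>2 / (2 * \<epsilon>)"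
proof -
  have "0 \<le> (\<epsilon> * p - q)\<^sup>2 / (2 * \<epsilon>)" using assms by simp
  also have "\<dots> = \<epsilon> / 2 * p\<^sup>2 + q\<^sup>2 / (2 * \<epsilon>) - p * q"
    using assms by (simp add: power2_diff field_simps power2_eq_square)
  finally show ?thesis by simp
qed

text \<open>
  Read \<open>v\<close> and \<open>v'\<close> as the plant field at the frozen and at the actual input, \<open>p\<close> as the distance of the
  state from the frozen steady state and \<open>q\<close> as the distance of the inputs. The mismatch term
  \<open>l * \<zeta> * p * q\<close> is absorbed by Young's inequality with parameter \<open>\<mu>\<close>, which spends exactly half of the
  decrease \<open>\<mu> * p\<^sup>2\<close>; the other half is expressed through \<open>W\<close>.
\<close>

lemma plant_dissipation:
  fixes DW v v' :: "'a::real_inner" and p q W :: real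
  assumes decrease: "DW \<bullet> v \<le> - \<mu> * p\<^sup>2" and grad: "norm DW \<le> \<zeta> * p"
    and lip: "norm (v' - v) \<le> l * q" and W: "W \<le> d * p\<^sup>2"
    and pos: "\<mu> > 0" "d > 0"
  shows "DW \<bullet> v' \<le> - (\<mu> / (2 * d)) * W + l\<^sup>2 * \<zeta>\<^sup>2 / (2 * \<mu>) * q\<^sup>2"
proof -
  have "DW \<bullet> (v' - v) \<le> norm DW * norm (v' - v)"
    by (rule norm_cauchy_schwarz)
  also have "\<dots> \<le> (\<zeta> * p) * (l * q)"
    using grad lip by (intro mult_mono) (auto intro: order_trans[OF norm_ge_zero])
  also have "\<dots> = p * (l * \<zeta> * q)" by simp
  also have "\<dots> \<le> \<mu> / 2 * p\<^sup>2 + (l * \<zeta> * q)\<^sup>2 / (2 * \<mu>)"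
    using pos(1) by (rule young_inequality)
  finally have "DW \<bullet> v' \<le> - (\<mu> / 2) * p\<^sup>2 + l\<^sup>2 * \<zeta>\<^sup>2 / (2 * \<mu>) * q\<^sup>2"
    using decrease by (simp add: inner_diff_right power_mult_distrib)
  moreover have "\<mu> / (2 * d) * W \<le> \<mu> / (2 * d) * (d * p\<^sup>2)"
    using W pos by (intro mult_left_mono) auto
  ultimately show ?thesis using pos by simp
qed

text \<open>
  Split the field at \<open>(u, y)\<close>, relative to its zero \<open>(u0, y0)\<close>, into the change of the partial gradient of
  \<open>\<Phi>\<close> in \<open>u\<close> (strongly monotone, gain \<open>\<mu>\<close>), the change of the Jacobian term in \<open>u\<close> (loss at most \<open>lu\<close>),
  and the change in \<open>y\<close> at \<open>u0\<close>. The last one is a cross term; Young's inequality with parameter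
  \<open>\<mu> - lu\<close> charges half of the net gain to it.
\<close>

lemma gradient_flow_dissipation:
  fixes h :: "real^'m \<Rightarrow> real^'p"
  assumes \<Phi>: "\<Phi> differentiable_on UNIV"
    and convex: "strongly_convex \<mu> (\<lambda>u. \<Phi> (u, y))"
    and lip_y: "ly-lipschitz_on UNIV (\<lambda>y. H_tilde h u0 (grad \<Phi> (u0, y)))"
    and lip_u: "lu-lipschitz_on UNIV (\<lambda>u. transpose (jacobian h (at u)) *v snd (grad \<Phi> (u, y)))"
    and less: "lu < \<mu>"
    and stationary: "H_tilde h u0 (grad \<Phi> (u0, y0)) = 0"
  shows "(\<mu> - lu) / 2 * (norm (u - u0))\<^sup>2 - ly\<^sup>2 / (2 * (\<mu> - lu)) * (norm (y - y0))\<^sup>2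
    \<le> (u - u0) \<bullet> H_tilde h u (grad \<Phi> (u, y))"
proof -
  define q r where "q = norm (u - u0)" and "r = norm (y - y0)"
  define A where "A v = transpose (jacobian h (at v)) *v snd (grad \<Phi> (v, y))" for v
  have "\<Phi> differentiable (at z)" for z
    using \<Phi> by (metis UNIV_I differentiable_on_def)
  then have mono: "\<mu> * q\<^sup>2 \<le> (u - u0) \<bullet> (fst (grad \<Phi> (u, y)) - fst (grad \<Phi> (u0, y)))"
    unfolding q_def by (intro strongly_convex_gradient_monotone[OF convex] GDERIV_partial_fst)
  have "\<bar>(u - u0) \<bullet> (A u - A u0)\<bar> \<le> q * (lu * q)"
    unfolding q_def A_def
    by (rule order_trans[OF Cauchy_Schwarz_ineq2 mult_left_mono[OF lipschitz_on_normD[OF lip_u]]]) auto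
  then have A: "- (lu * q\<^sup>2) \<le> (u - u0) \<bullet> (A u - A u0)"
    by (simp add: power2_eq_square mult.left_commute abs_le_iff)
  have "\<bar>(u - u0) \<bullet> H_tilde h u0 (grad \<Phi> (u0, y))\<bar> \<le> q * (ly * r)"
    unfolding q_def r_def using lipschitz_on_normD[OF lip_y, of y y0] stationary
    by (intro order_trans[OF Cauchy_Schwarz_ineq2 mult_left_mono]) auto
  also have "\<dots> \<le> (\<mu> - lu) / 2 * q\<^sup>2 + (ly * r)\<^sup>2 / (2 * (\<mu> - lu))"
    using less by (intro young_inequality) simp
  finally have cross: "- ((\<mu> - lu) / 2 * q\<^sup>2 + ly\<^sup>2 / (2 * (\<mu> - lu)) * r\<^sup>2)
      \<le> (u - u0) \<bullet> H_tilde h u0 (grad \<Phi> (u0, y))"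
    by (simp add: power_mult_distrib abs_le_iff)
  have "(u - u0) \<bullet> H_tilde h u (grad \<Phi> (u, y))
      = (u - u0) \<bullet> (fst (grad \<Phi> (u, y)) - fst (grad \<Phi> (u0, y)))
        + (u - u0) \<bullet> (A u - A u0) + (u - u0) \<bullet> H_tilde h u0 (grad \<Phi> (u0, y))"
    by (simp add: H_tilde_def A_def algebra_simps del: transpose_matrix_vector)
  moreover have "\<mu> * q\<^sup>2 - lu * q\<^sup>2 - (\<mu> - lu) / 2 * q\<^sup>2 = (\<mu> - lu) / 2 * q\<^sup>2"
    by (simp add: field_simps)
  ultimately show ?thesis
    using mono A cross unfolding q_def r_def by linarith
qed

text \<open>
  The hypothesis on \<open>\<xi>\<close> implies \<open>\<theta>1 * \<theta>2 < \<mu>1 * \<mu>2\<close>, so that \<open>\<theta>2 / \<mu>1\<close> lies below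
  \<open>\<mu>2 / \<theta>1\<close>. Their mediant \<open>(\<theta>2 + \<mu>2) / (\<theta>1 + \<mu>1)\<close> lies strictly between them and makes sense even
  when \<open>\<theta>1 = 0\<close>.
\<close>

lemma small_gain_weight:
  fixes \<mu>1 \<mu>2 \<theta>1 \<theta>2 \<xi> :: real
  assumes nonneg: "\<theta>1 \<ge> 0" "\<theta>2 \<ge> 0" and pos: "\<mu>1 > 0" "\<mu>2 > 0"
    and gain: "- \<mu>1 + \<xi> * \<theta>1 < 0" "\<theta>2 - \<xi> * \<mu>2 < 0"
  obtains a where "a > 0" "\<theta>2 < a * \<mu>1" "a * \<theta>1 < \<mu>2"
proof
  have "\<theta>1 * \<theta>2 \<le> \<theta>1 * (\<xi> * \<mu>2)"
    using nonneg gain(2) by (intro mult_left_mono) auto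
  also have "\<dots> = (\<xi> * \<theta>1) * \<mu>2" by simp
  also have "\<dots> < \<mu>1 * \<mu>2"
    using pos(2) gain(1) by (intro mult_strict_right_mono) auto
  finally have "\<theta>1 * \<theta>2 < \<mu>1 * \<mu>2" .
  then show "\<theta>2 < (\<theta>2 + \<mu>2) / (\<theta>1 + \<mu>1) * \<mu>1" "(\<theta>2 + \<mu>2) / (\<theta>1 + \<mu>1) * \<theta>1 < \<mu>2"
    using nonneg pos by (simp_all add: field_simps)
  show "(\<theta>2 + \<mu>2) / (\<theta>1 + \<mu>1) > 0"
    using nonneg pos by simp
qed

lemma bounded_bilinear_transpose_mult:
  "bounded_bilinear (\<lambda>(A :: real^'m^'p) v. transpose A *v v)"
  unfolding bilinear_conv_bounded_bilinear[symmetric] bilinear_def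
  by (intro conjI allI linearI)
    (simp_all add: vec_eq_iff transpose_def matrix_vector_mult_def algebra_simps sum.distrib
      sum_distrib_left del: transpose_matrix_vector)

lemma lipschitz_on_compacts_closed_loop:
  fixes h :: "real^'m \<Rightarrow> real^'p"
  assumes f: "lipschitz_on_compacts f" and g: "lipschitz_on_compacts g"
    and J: "lipschitz_on_compacts (\<lambda>u. jacobian h (at u))"
    and \<Phi>: "lipschitz_on_compacts (grad \<Phi>)"
  shows "lipschitz_on_compacts (closed_loop f g h \<Phi> \<alpha>)"
proof -
  note proj = bounded_linear_imp_lipschitz_on_compacts[OF bounded_linear_fst]
    bounded_linear_imp_lipschitz_on_compacts[OF bounded_linear_snd]
  have D: "lipschitz_on_compacts (\<lambda>w. grad \<Phi> (snd w, g (fst w)))"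
    by (intro lipschitz_on_compacts_compose[OF _ \<Phi>] lipschitz_on_compacts_Pair proj
        lipschitz_on_compacts_compose[OF _ g])
  have "lipschitz_on_compacts (\<lambda>w. (f w, - \<alpha> *\<^sub>R (fst (grad \<Phi> (snd w, g (fst w)))
      + transpose (jacobian h (at (snd w))) *v snd (grad \<Phi> (snd w, g (fst w))))))"
    by (intro lipschitz_on_compacts_Pair f lipschitz_on_compacts_scaleR lipschitz_on_compacts_add
        lipschitz_on_compacts_bilinear[OF bounded_bilinear_transpose_mult]
        lipschitz_on_compacts_compose[OF D] lipschitz_on_compacts_compose[OF _ J] proj)
  then show ?thesis
    by (simp add: closed_loop_def H_tilde_def case_prod_beta' del: transpose_matrix_vector)
qed

theorem corollary1:
  fixes f :: "(real^'n) \<times> (real^'m) \<Rightarrow> real^'n"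
    and g :: "real^'n \<Rightarrow> real^'p"
    and s :: "real^'m \<Rightarrow> real^'n"
    and h :: "real^'m \<Rightarrow> real^'p"
    and \<Phi> :: "(real^'m) \<times> (real^'p) \<Rightarrow> real"
    and W :: "(real^'n) \<times> (real^'m) \<Rightarrow> real"
    and lf lg l\<Phi>y l\<Phi>u \<mu>\<Phi> c3 d3 \<mu>3 \<zeta>3 \<mu>1 \<mu>2 \<theta>1 \<theta>2 \<alpha> :: real
  assumes f_lipschitz: "locally_lipschitz f"
    and g_lipschitz: "locally_lipschitz g"
    and plant_stable: "\<And>u. \<exists>z. globally_asymptotically_stable (\<lambda>x. f (x, u)) z"
    and steady_state: "\<And>u. f (s u, u) = 0"
    and steady_output: "\<And>u. h u = g (s u)"
    and h_differentiable: "h differentiable_on UNIV"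
    and h_C1: "continuous_on UNIV (\<lambda>u. jacobian h (at u))"
    and h_jacobian_lipschitz: "locally_lipschitz (\<lambda>u. jacobian h (at u))"
    and cost_differentiable: "\<Phi> differentiable_on UNIV"
    and cost_C1: "continuous_on UNIV (grad \<Phi>)"
    and cost_grad_lipschitz: "locally_lipschitz (grad \<Phi>)"
    and cost_solvable: "\<exists>z. solves_min \<Phi> h z"
    and constants: "lf \<ge> 0" "lg \<ge> 0" "l\<Phi>y \<ge> 0" "l\<Phi>u \<ge> 0" "\<mu>\<Phi> > 0"
    and a_f: "\<And>x. lf-lipschitz_on UNIV (\<lambda>u. f (x, u))"
    and a_g: "lg-lipschitz_on UNIV g"
    and b_constants: "c3 > 0" "d3 > 0" "\<mu>3 > 0" "\<zeta>3 > 0"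
    and b_differentiable: "\<And>x u. (\<lambda>x'. W (x', u)) differentiable (at x)"
    and b_lower: "\<And>x u. c3 * (norm (x - s u))\<^sup>2 \<le> W (x, u)"
    and b_upper: "\<And>x u. W (x, u) \<le> d3 * (norm (x - s u))\<^sup>2"
    and b_decrease:
      "\<And>x u. grad (\<lambda>x'. W (x', u)) x \<bullet> f (x, u) \<le> - \<mu>3 * (norm (x - s u))\<^sup>2"
    and b_grad: "\<And>x u. norm (grad (\<lambda>x'. W (x', u)) x) \<le> \<zeta>3 * norm (x - s u)"
    and c_convex: "\<And>y. strongly_convex \<mu>\<Phi> (\<lambda>u. \<Phi> (u, y))"
    and c_lipschitz: "\<And>u. l\<Phi>y-lipschitz_on UNIV (\<lambda>y. H_tilde h u (grad \<Phi> (u, y)))"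
    and d_lipschitz:
      "\<And>y. l\<Phi>u-lipschitz_on UNIV
             (\<lambda>u. transpose (jacobian h (at u)) *v snd (grad \<Phi> (u, y)))"
    and d_less: "\<mu>\<Phi> > l\<Phi>u"
    and \<mu>1_eq: "\<mu>1 = \<mu>3 / (2 * d3)"
    and \<theta>1_eq: "\<theta>1 = lf\<^sup>2 * \<zeta>3\<^sup>2 / (2 * \<mu>3)"
    and \<theta>2_eq: "\<theta>2 = lg\<^sup>2 * l\<Phi>y\<^sup>2 / (2 * (\<mu>\<Phi> - l\<Phi>u) * c3)"
    and \<mu>2_eq: "\<mu>2 = (\<mu>\<Phi> - l\<Phi>u) / 2"
    and small_gain: "\<exists>\<xi>>0. - \<mu>1 + \<xi> * \<theta>1 < 0 \<and> \<theta>2 - \<xi> * \<mu>2 < 0"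
    and \<alpha>_pos: "\<alpha> > 0"
  shows "\<exists>u_opt y_opt.
     (\<forall>z. solves_min \<Phi> h z \<longleftrightarrow> z = (u_opt, y_opt)) \<and>
     globally_exponentially_stable (closed_loop f g h \<Phi> \<alpha>) (s u_opt, u_opt) \<and>
     (\<forall>\<phi>. ode_solution (closed_loop f g h \<Phi> \<alpha>) {0..} \<phi> \<longrightarrow>
        ((\<lambda>t. (snd (\<phi> t), g (fst (\<phi> t)))) \<longlongrightarrow> (u_opt, y_opt)) at_top)"
proof -
  have \<Phi>: "\<Phi> differentiable (at z)" and h: "h differentiable (at u)" for z u
    using cost_differentiable h_differentiable by (metis UNIV_I differentiable_on_def)+
  have equilibrium: "y = h u" "closed_loop f g h \<Phi> \<alpha> (s u, u) = 0" if "solves_min \<Phi> h (u, y)" for u y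
    using solves_min_stationary[OF that \<Phi> h] steady_state[of u] steady_output[of u]
    by (simp_all add: closed_loop_def zero_prod_def)
  obtain u0 where u0: "solves_min \<Phi> h (u0, h u0)"
    using cost_solvable equilibrium(1) by (metis surj_pair)
  have stationary: "H_tilde h u0 (grad \<Phi> (u0, h u0)) = 0"
    using solves_min_stationary(2)[OF u0 \<Phi> h] .
  have F: "lipschitz_on_compacts (closed_loop f g h \<Phi> \<alpha>)"
    by (intro lipschitz_on_compacts_closed_loop locally_lipschitz_imp_lipschitz_on_compacts
        f_lipschitz g_lipschitz h_jacobian_lipschitz cost_grad_lipschitz)
  have pos: "\<mu>1 > 0" "\<mu>2 > 0" "\<theta>1 \<ge> 0" "\<theta>2 \<ge> 0"
    using b_constants d_less by (simp_all add: \<mu>1_eq \<mu>2_eq \<theta>1_eq \<theta>2_eq)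
  obtain a where a: "a > 0" "\<theta>2 < a * \<mu>1" "a * \<theta>1 < \<mu>2"
    using small_gain small_gain_weight[OF pos(3,4,1,2)] by blast
  define DW where "DW x = grad (\<lambda>x'. W (x', u0)) x" for x
  define V where "V w = a * W (fst w, u0) + (norm (snd w - u0))\<^sup>2 / (2 * \<alpha>)" for w
  define V' where "V' w v = a * (fst v \<bullet> DW (fst w)) + (snd w - u0) \<bullet> snd v / \<alpha>"
    for w v :: "(real^'n) \<times> (real^'m)"
  \<comment> \<open>The decay rate of the sum is the smaller of the two rates relative to the terms of \<open>V\<close>.\<close>
  define k where "k = min ((a * \<mu>1 - \<theta>2) / a) (2 * \<alpha> * (\<mu>2 - a * \<theta>1))"
  have norm_eq: "(norm (w - (s u0, u0)))\<^sup>2 = (norm (fst w - s u0))\<^sup>2 + (norm (snd w - u0))\<^sup>2" for w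
    by (cases w) (simp add: norm_Pair)
  have stable: "globally_exponentially_stable (closed_loop f g h \<Phi> \<alpha>) (s u0, u0)"
  proof (rule lyapunov_globally_exponentially_stable[OF F equilibrium(2)[OF u0]])
    show "min (a * c3) (1 / (2 * \<alpha>)) > 0" "max (a * d3) (1 / (2 * \<alpha>)) > 0" "k > 0"
      using a b_constants \<alpha>_pos by (auto simp: k_def less_max_iff_disj)
  next
    fix w
    have "min (a * c3) (1 / (2 * \<alpha>)) * (norm (fst w - s u0))\<^sup>2 \<le> a * c3 * (norm (fst w - s u0))\<^sup>2"
      "min (a * c3) (1 / (2 * \<alpha>)) * (norm (snd w - u0))\<^sup>2 \<le> 1 / (2 * \<alpha>) * (norm (snd w - u0))\<^sup>2"
      by (intro mult_right_mono; simp)+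
    moreover have "a * (c3 * (norm (fst w - s u0))\<^sup>2) \<le> a * W (fst w, u0)"
      using a(1) by (intro mult_left_mono b_lower) auto
    ultimately show "min (a * c3) (1 / (2 * \<alpha>)) * (norm (w - (s u0, u0)))\<^sup>2 \<le> V w"
      by (simp add: norm_eq V_def distrib_left)
  next
    fix w
    have "a * d3 * (norm (fst w - s u0))\<^sup>2 \<le> max (a * d3) (1 / (2 * \<alpha>)) * (norm (fst w - s u0))\<^sup>2"
      "1 / (2 * \<alpha>) * (norm (snd w - u0))\<^sup>2 \<le> max (a * d3) (1 / (2 * \<alpha>)) * (norm (snd w - u0))\<^sup>2"
      by (intro mult_right_mono; simp)+
    moreover have "a * W (fst w, u0) \<le> a * (d3 * (norm (fst w - s u0))\<^sup>2)"
      using a(1) by (intro mult_left_mono b_upper) auto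
    ultimately show "V w \<le> max (a * d3) (1 / (2 * \<alpha>)) * (norm (w - (s u0, u0)))\<^sup>2"
      by (simp add: norm_eq V_def distrib_left)
  next
    fix w :: "(real^'n) \<times> (real^'m)"
    have fst': "(fst has_derivative fst) (at w)"
      by (auto intro!: derivative_eq_intros)
    have "((\<lambda>x. W (x, u0)) has_derivative (\<lambda>v. v \<bullet> DW (fst w))) (at (fst w))"
      using GDERIV_grad[OF b_differentiable] unfolding gderiv_def DW_def .
    from has_derivative_compose[OF fst' this]
    show "(V has_derivative V' w) (at w)"
      unfolding V_def[abs_def] V'_def[abs_def] power2_norm_eq_inner
      using \<alpha>_pos
      by (auto intro!: derivative_eq_intros simp: fun_eq_iff inner_commute field_simps)
  next
    fix w :: "(real^'n) \<times> (real^'m)"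
    obtain x u where w: "w = (x, u)" by (cases w)
    define q where "q = (norm (u - u0))\<^sup>2"
    have "DW x \<bullet> f (x, u) \<le> - \<mu>1 * W (x, u0) + \<theta>1 * q"
      unfolding DW_def q_def \<mu>1_eq \<theta>1_eq
      by (rule plant_dissipation[OF b_decrease b_grad lipschitz_on_normD[OF a_f] b_upper])
        (use b_constants in auto)
    then have plant: "a * (f (x, u) \<bullet> DW x) \<le> a * (- \<mu>1 * W (x, u0) + \<theta>1 * q)"
      using a(1) by (simp add: inner_commute)
    have "norm (g x - h u0) \<le> lg * norm (x - s u0)"
      using lipschitz_on_normD[OF a_g, of x "s u0"] by (simp add: steady_output)
    then have "(norm (g x - h u0))\<^sup>2 \<le> lg\<^sup>2 * (norm (x - s u0))\<^sup>2"
      by (metis norm_ge_zero power_mono power_mult_distrib)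
    also have "\<dots> \<le> lg\<^sup>2 * (W (x, u0) / c3)"
      using b_lower[of x u0] b_constants by (intro mult_left_mono) (auto simp: field_simps)
    finally have "l\<Phi>y\<^sup>2 / (2 * (\<mu>\<Phi> - l\<Phi>u)) * (norm (g x - h u0))\<^sup>2
        \<le> l\<Phi>y\<^sup>2 / (2 * (\<mu>\<Phi> - l\<Phi>u)) * (lg\<^sup>2 * (W (x, u0) / c3))"
      using d_less by (intro mult_left_mono) auto
    also have "\<dots> = \<theta>2 * W (x, u0)"
      by (simp add: \<theta>2_eq)
    finally have "\<mu>2 * q - \<theta>2 * W (x, u0) \<le> (u - u0) \<bullet> H_tilde h u (grad \<Phi> (u, g x))"
      using gradient_flow_dissipation[OF cost_differentiable c_convex c_lipschitz d_lipschitz d_less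
          stationary, of u "g x"]
      unfolding \<mu>2_eq q_def by linarith
    moreover have "V' w (closed_loop f g h \<Phi> \<alpha> w)
        = a * (f (x, u) \<bullet> DW x) - (u - u0) \<bullet> H_tilde h u (grad \<Phi> (u, g x))"
      using \<alpha>_pos by (simp add: V'_def w closed_loop_def)
    ultimately have "V' w (closed_loop f g h \<Phi> \<alpha> w)
        \<le> - (a * \<mu>1 - \<theta>2) * W (x, u0) - (\<mu>2 - a * \<theta>1) * q"
      using plant by (simp add: algebra_simps)
    also have "\<dots> \<le> - (k * a) * W (x, u0) - k / (2 * \<alpha>) * q"
    proof -
      have "k * a \<le> (a * \<mu>1 - \<theta>2) / a * a" "k / (2 * \<alpha>) \<le> 2 * \<alpha> * (\<mu>2 - a * \<theta>1) / (2 * \<alpha>)"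
        using a(1) \<alpha>_pos unfolding k_def by (intro mult_right_mono divide_right_mono; simp)+
      then have "k * a \<le> a * \<mu>1 - \<theta>2" "k / (2 * \<alpha>) \<le> \<mu>2 - a * \<theta>1"
        using a(1) \<alpha>_pos by simp_all
      moreover have "0 \<le> c3 * (norm (x - s u0))\<^sup>2"
        using b_constants by simp
      then have "0 \<le> W (x, u0)"
        using b_lower order_trans by blast
      moreover have "0 \<le> q" by (simp add: q_def)
      ultimately have "k * a * W (x, u0) \<le> (a * \<mu>1 - \<theta>2) * W (x, u0)"
        "k / (2 * \<alpha>) * q \<le> (\<mu>2 - a * \<theta>1) * q"
        by (intro mult_right_mono; simp)+
      then show ?thesis
        unfolding mult_minus_left by linarith
    qed
    also have "\<dots> = - k * V w"
      by (simp add: V_def w q_def algebra_simps)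
    finally show "V' w (closed_loop f g h \<Phi> \<alpha> w) \<le> - k * V w" .
  qed
  have unique: "z = (u0, h u0)" if "solves_min \<Phi> h z" for z
  proof -
    obtain u y where z: "z = (u, y)" by (cases z)
    have "(s u, u) = (s u0, u0)"
      using globally_exponentially_stable_unique_equilibrium[OF stable equilibrium(2)] that z by blast
    then show ?thesis
      using equilibrium(1) that z by simp
  qed
  have "((\<lambda>t. (snd (\<phi> t), g (fst (\<phi> t)))) \<longlongrightarrow> (u0, h u0)) at_top"
    if "ode_solution (closed_loop f g h \<Phi> \<alpha>) {0..} \<phi>" for \<phi>
  proof -
    have lim: "(\<phi> \<longlongrightarrow> (s u0, u0)) at_top"
      using stable that by (rule globally_exponentially_stable_tendsto)
    have "isCont g (s u0)"
      using lipschitz_on_continuous_on[OF a_g] by (simp add: continuous_on_eq_continuous_at)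
    then show ?thesis
      using tendsto_fst[OF lim] tendsto_snd[OF lim]
      by (auto intro!: tendsto_Pair simp: steady_output intro: isCont_tendsto_compose)
  qed
  with stable unique u0 show ?thesis by blast
qed

end
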